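(* Let $0<m<M$ be scalars and let $A,B\in\mathcal{B}(\mathcal{H})$ be self-adjoint operators with $m\le A\le M$ and $m\le B\le M$. Let $f:[0,2M]\to[0,\infty)$ be a continuous function with $f(t)>0$ for all $t\in[m,M]$. (1) If $f$ is convex and $f(0)=0$, then $$f(A)+f(B)\le K(m,M,f)\,f(A+B).$$ (2) If $f$ is concave, then $$f(A)+f(B)\ge k(m,M,f)\,f(A+B).$$
   Context: $\mathcal{B}(\mathcal{H})$ is the algebra of bounded linear operators on a complex Hilbert space $\mathcal{H}$. For self-adjoint operators, $A\ge B$ means $\langle Ax,x\rangle\ge\langle Bx,x\rangle$ for all $x\in\mathcal{H}$; for scalars $m,M$, $m\le A\le M$ means $m\langle x,x\rangle\le\langle Ax,x\rangle\le M\langle x,x\rangle$ for all $x\in\mathcal{H}$. Expressions $f(A)$ are understood via the continuous functional calculus. Convexity and concavity are the ordinary scalar notions. For $m<M$ and a continuous function $f$ that is positive on $[m,M]$, $$K(m,M,f)=\max\left\{\frac{1}{f(t)}\left(\frac{M-t}{M-m}f(m)+\frac{t-m}{M-m}f(M)\right):t\in[m,M]\right\},$$ $$k(m,M,f)=\min\left\{\frac{1}{f(t)}\left(\frac{M-t}{M-m}f(m)+\frac{t-m}{M-m}f(M)\right):t\in[m,M]\right\}.$$ *)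

theory Defs
  imports "HOL-Analysis.Analysis"
begin

(* A complex Hilbert space. The real Banach space structure of the type is the one underlying the
   complex structure; the inner product is linear in its first argument. *)
class complex_hilbert = banach +
  fixes scaleC :: "complex \<Rightarrow> 'a \<Rightarrow> 'a"  (infixr "*\<^sub>C" 75)
    and cinner :: "'a \<Rightarrow> 'a \<Rightarrow> complex"
  assumes scaleC_add_right: "a *\<^sub>C (x + y) = a *\<^sub>C x + a *\<^sub>C y"
    and scaleC_add_left: "(a + b) *\<^sub>C x = a *\<^sub>C x + b *\<^sub>C x"
    and scaleC_scaleC: "a *\<^sub>C (b *\<^sub>C x) = (a * b) *\<^sub>C x"
    and scaleC_one: "1 *\<^sub>C x = x"
    and scaleR_eq_scaleC: "r *\<^sub>R x = complex_of_real r *\<^sub>C x"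
    and cinner_commute: "cinner x y = cnj (cinner y x)"
    and cinner_add_left: "cinner (x + y) z = cinner x z + cinner y z"
    and cinner_scaleC_left: "cinner (a *\<^sub>C x) y = a * cinner x y"
    and cinner_ge_zero: "0 \<le> Re (cinner x x)"
    and cinner_eq_zero_iff: "cinner x x = 0 \<longleftrightarrow> x = 0"
    and norm_eq_sqrt_cinner: "norm x = sqrt (Re (cinner x x))"

(* The algebra B(H), as the set of complex-linear elements of the Banach space of bounded
   real-linear maps; the operator norm, sum, composition and identity are those of that space. *)
definition bounded_ops :: "('a::complex_hilbert \<Rightarrow>\<^sub>L 'a) set" where
  "bounded_ops = {T. \<forall>c x. blinfun_apply T (c *\<^sub>C x) = c *\<^sub>C blinfun_apply T x}"

definition is_adjoint :: "('a::complex_hilbert \<Rightarrow>\<^sub>L 'a) \<Rightarrow> ('a \<Rightarrow>\<^sub>L 'a) \<Rightarrow> bool" where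
  "is_adjoint T S \<longleftrightarrow>
     (\<forall>x y. cinner (blinfun_apply T x) y = cinner x (blinfun_apply S y))"

definition self_adjoint :: "('a::complex_hilbert \<Rightarrow>\<^sub>L 'a) \<Rightarrow> bool" where
  "self_adjoint A \<longleftrightarrow> A \<in> bounded_ops \<and> is_adjoint A A"

(* For self-adjoint operators the values cinner (A x) x are real, so Re only changes the type. *)
definition op_le :: "('a::complex_hilbert \<Rightarrow>\<^sub>L 'a) \<Rightarrow> ('a \<Rightarrow>\<^sub>L 'a) \<Rightarrow> bool" where
  "op_le A B \<longleftrightarrow> self_adjoint A \<and> self_adjoint B \<and>
     (\<forall>x. Re (cinner (blinfun_apply A x) x) \<le> Re (cinner (blinfun_apply B x) x))"

definition op_between :: "real \<Rightarrow> ('a::complex_hilbert \<Rightarrow>\<^sub>L 'a) \<Rightarrow> real \<Rightarrow> bool" where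
  "op_between m A M \<longleftrightarrow>
     (\<forall>x. m * Re (cinner x x) \<le> Re (cinner (blinfun_apply A x) x) \<and>
          Re (cinner (blinfun_apply A x) x) \<le> M * Re (cinner x x))"

definition spectrum :: "('a::complex_hilbert \<Rightarrow>\<^sub>L 'a) \<Rightarrow> complex set" where
  "spectrum A = {z. \<not> (\<exists>S\<in>bounded_ops. \<forall>x.
     blinfun_apply S (blinfun_apply A x - z *\<^sub>C x) = x \<and>
     blinfun_apply A (blinfun_apply S x) - z *\<^sub>C blinfun_apply S x = x)}"

(* \<Phi> is a continuous unital *-homomorphism from C(spectrum A) (with the sup norm) to B(H) that
   sends the identity function to A. Elements of C(spectrum A) are represented by total functions
   that are continuous on the spectrum; values off the spectrum are irrelevant by the second
   clause. *)
definition is_functional_calculus ::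
  "('a::complex_hilbert \<Rightarrow>\<^sub>L 'a) \<Rightarrow> ((complex \<Rightarrow> complex) \<Rightarrow> ('a \<Rightarrow>\<^sub>L 'a)) \<Rightarrow> bool" where
  "is_functional_calculus A \<Phi> \<longleftrightarrow>
     (let C = {g. continuous_on (spectrum A) g} in
       (\<forall>g\<in>C. \<Phi> g \<in> bounded_ops) \<and>
       (\<forall>g\<in>C. \<forall>h\<in>C. (\<forall>z\<in>spectrum A. g z = h z) \<longrightarrow> \<Phi> g = \<Phi> h) \<and>
       (\<forall>g\<in>C. \<forall>h\<in>C. \<Phi> (\<lambda>z. g z + h z) = \<Phi> g + \<Phi> h) \<and>
       (\<forall>g\<in>C. \<forall>c x. blinfun_apply (\<Phi> (\<lambda>z. c * g z)) x = c *\<^sub>C blinfun_apply (\<Phi> g) x) \<and>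
       (\<forall>g\<in>C. \<forall>h\<in>C. \<Phi> (\<lambda>z. g z * h z) = \<Phi> g o\<^sub>L \<Phi> h) \<and>
       (\<forall>g\<in>C. is_adjoint (\<Phi> g) (\<Phi> (\<lambda>z. cnj (g z)))) \<and>
       \<Phi> (\<lambda>z. 1) = id_blinfun \<and>
       \<Phi> (\<lambda>z. z) = A \<and>
       (\<forall>G. \<forall>g\<in>C. (\<forall>n::nat. G n \<in> C) \<and> uniform_limit (spectrum A) G g sequentially \<longrightarrow>
          (\<lambda>n. \<Phi> (G n)) \<longlonglongrightarrow> \<Phi> g))"

(* f(A) for self-adjoint A and f continuous on the (real) spectrum of A. The functional calculus
   \<Phi> exists and is unique on C(spectrum A), so the description is proper in that case. *)
definition cfc :: "(real \<Rightarrow> real) \<Rightarrow> ('a::complex_hilbert \<Rightarrow>\<^sub>L 'a) \<Rightarrow> ('a \<Rightarrow>\<^sub>L 'a)" where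
  "cfc f A =
     (THE T. \<exists>\<Phi>. is_functional_calculus A \<Phi> \<and> T = \<Phi> (\<lambda>z. complex_of_real (f (Re z))))"

definition chord_ratio :: "real \<Rightarrow> real \<Rightarrow> (real \<Rightarrow> real) \<Rightarrow> real \<Rightarrow> real" where
  "chord_ratio m M f t =
     (1 / f t) * ((M - t) / (M - m) * f m + (t - m) / (M - m) * f M)"

(* For m < M and f continuous and positive on [m, M], chord_ratio is continuous there, so the
   maximum and the minimum exist. *)
definition K_const :: "real \<Rightarrow> real \<Rightarrow> (real \<Rightarrow> real) \<Rightarrow> real" where
  "K_const m M f = (GREATEST y. y \<in> chord_ratio m M f ` {m..M})"

definition k_const :: "real \<Rightarrow> real \<Rightarrow> (real \<Rightarrow> real) \<Rightarrow> real" where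
  "k_const m M f = (LEAST y. y \<in> chord_ratio m M f ` {m..M})"

end

theory Submission
  imports Defs "HOL-Computational_Algebra.Fundamental_Theorem_Algebra"
begin

text \<open>On \<open>[m, M]\<close> a convex \<open>f\<close> lies below its chord \<open>a t + b\<close>, so
  \<open>f(A) + f(B) \<le> a (A + B) + 2 b\<close>. For \<open>s\<close> in \<open>[2 m, 2 M]\<close> one has
  \<open>a s + 2 b = 2 (a (s / 2) + b) \<le> 2 K f(s / 2) \<le> K f(s)\<close>, the last step by convexity and
  \<open>f(0) = 0\<close>; apply this to \<open>A + B\<close>. The concave case is dual.

  The functional calculus of a self-adjoint \<open>A\<close> is obtained as a limit of polynomials in \<open>A\<close>,
  which needs \<open>\<parallel>p(A)\<parallel> \<le> sup |p|\<close> over the spectrum. The spectrum consists of those \<open>z\<close> for which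
  \<open>A - z\<close> is not bounded below. With \<open>r = \<parallel>p(A)\<parallel>\<close>, the operator \<open>r\<^sup>2 - p(A)* p(A)\<close> is not bounded
  below, so factoring the polynomial \<open>r\<^sup>2 - cnj p p\<close> over the complex numbers yields a root \<open>z\<close> in
  the spectrum, and \<open>|p(z)| = r\<close>.\<close>

section \<open>The complex Hilbert space and the spectrum\<close>

lemma scaleC_zero_left [simp]: "0 *\<^sub>C (x::'a::complex_hilbert) = 0"
  using scaleR_eq_scaleC[of 0 x] by simp

lemma scaleC_zero_right [simp]: "c *\<^sub>C (0::'a::complex_hilbert) = 0"
  using scaleC_add_right[of c "0::'a" 0] by simp

lemma scaleC_minus_right: "c *\<^sub>C (- (x::'a::complex_hilbert)) = - (c *\<^sub>C x)"
  using scaleC_add_right[of c x "- x"] by (simp add: minus_unique)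

lemma scaleC_diff_right: "c *\<^sub>C ((x::'a::complex_hilbert) - y) = c *\<^sub>C x - c *\<^sub>C y"
  using scaleC_add_right[of c x "- y"] by (simp add: scaleC_minus_right)

lemma scaleC_scaleR_commute: "c *\<^sub>C (r *\<^sub>R (x::'a::complex_hilbert)) = r *\<^sub>R (c *\<^sub>C x)"
  by (simp add: scaleR_eq_scaleC scaleC_scaleC mult.commute)

lemma cinner_add_right: "cinner (x::'a::complex_hilbert) (y + z) = cinner x y + cinner x z"
  by (metis cinner_add_left cinner_commute complex_cnj_add)

lemma cinner_scaleC_right: "cinner (x::'a::complex_hilbert) (a *\<^sub>C y) = cnj a * cinner x y"
  by (metis cinner_scaleC_left cinner_commute complex_cnj_mult)

lemma cinner_scaleR_left: "cinner (r *\<^sub>R (x::'a::complex_hilbert)) y = r *\<^sub>R cinner x y"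
  by (simp add: scaleR_eq_scaleC cinner_scaleC_left scaleR_conv_of_real)

lemma cinner_scaleR_right: "cinner (x::'a::complex_hilbert) (r *\<^sub>R y) = r *\<^sub>R cinner x y"
  by (simp add: scaleR_eq_scaleC cinner_scaleC_right scaleR_conv_of_real)

lemma cinner_zero_left [simp]: "cinner (0::'a::complex_hilbert) y = 0"
  using cinner_scaleC_left[of 0 "0::'a" y] by simp

lemma cinner_zero_right [simp]: "cinner (x::'a::complex_hilbert) 0 = 0"
  using cinner_scaleC_right[of x 0 0] by simp

lemma cinner_diff_left: "cinner ((x::'a::complex_hilbert) - y) z = cinner x z - cinner y z"
  using cinner_add_left[of "x - y" y z] by simp

lemma cinner_diff_right: "cinner (x::'a::complex_hilbert) (y - z) = cinner x y - cinner x z"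
  using cinner_add_right[of x "y - z" z] by simp

lemma cinner_self: "cinner (x::'a::complex_hilbert) x = complex_of_real ((norm x)\<^sup>2)"
proof -
  have "Im (cinner x x) = 0"
    using arg_cong[OF cinner_commute[of x x], of Im] by simp
  then show ?thesis
    using cinner_ge_zero[of x] by (simp add: complex_eq_iff norm_eq_sqrt_cinner)
qed

lemma norm_diff_square:
  "(norm ((x::'a::complex_hilbert) - y))\<^sup>2 = (norm x)\<^sup>2 - 2 * Re (cinner x y) + (norm y)\<^sup>2"
proof -
  have "Re (cinner (x - y) (x - y)) = Re (cinner x x) - Re (cinner x y) - Re (cinner y x) + Re (cinner y y)"
    by (simp add: cinner_diff_left cinner_diff_right)
  moreover have "Re (cinner y x) = Re (cinner x y)"
    using arg_cong[OF cinner_commute[of x y], of Re] by simp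
  ultimately show ?thesis by (simp add: cinner_self)
qed

lemma norm_scaleC: "norm (c *\<^sub>C (x::'a::complex_hilbert)) = cmod c * norm x"
proof -
  have "cinner (c *\<^sub>C x) (c *\<^sub>C x) = (c * cnj c) * cinner x x"
    by (simp add: cinner_scaleC_left cinner_scaleC_right)
  then have "complex_of_real ((norm (c *\<^sub>C x))\<^sup>2) = complex_of_real ((cmod c * norm x)\<^sup>2)"
    by (simp add: cinner_self power_mult_distrib flip: complex_norm_square)
  then have "(norm (c *\<^sub>C x))\<^sup>2 = (cmod c * norm x)\<^sup>2"
    using of_real_eq_iff by blast
  then show ?thesis by (simp add: power2_eq_iff_nonneg)
qed

lemma cinner_Cauchy_Schwarz: "cmod (cinner (x::'a::complex_hilbert) y) \<le> norm x * norm y"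
proof (cases "y = 0")
  case False
  define N where "N = (norm y)\<^sup>2"
  have N: "N > 0" using False by (simp add: N_def)
  \<comment> \<open>With this coefficient \<open>a *\<^sub>C y\<close> is the orthogonal projection
    of \<open>x\<close> onto the line through \<open>y\<close>, so expanding the square of the
    distance gives the inequality.\<close>
  define a where "a = cinner x y / complex_of_real N"
  have "cinner x (a *\<^sub>C y) = cnj (cinner x y) * cinner x y / complex_of_real N"
    by (simp add: cinner_scaleC_right a_def)
  then have 1: "Re (cinner x (a *\<^sub>C y)) = (cmod (cinner x y))\<^sup>2 / N"
    by (metis Re_complex_of_real complex_norm_square mult.commute of_real_divide)
  have 2: "(norm (a *\<^sub>C y))\<^sup>2 = (cmod (cinner x y))\<^sup>2 / N"
    using N by (simp add: norm_scaleC a_def norm_divide power_mult_distrib power_divide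
        flip: N_def) (simp add: power2_eq_square)
  have "0 \<le> (norm (x - a *\<^sub>C y))\<^sup>2" by simp
  then have "(cmod (cinner x y))\<^sup>2 / N \<le> (norm x)\<^sup>2"
    by (simp only: norm_diff_square 1 2)
  then have "(cmod (cinner x y))\<^sup>2 \<le> (norm x * norm y)\<^sup>2"
    using N by (simp add: field_simps N_def power_mult_distrib)
  then show ?thesis by (rule power2_le_imp_le) simp
qed simp

lemma bounded_bilinear_cinner: "bounded_bilinear (cinner :: 'a::complex_hilbert \<Rightarrow> 'a \<Rightarrow> complex)"
  by (rule bounded_bilinear.intro)
    (auto simp: cinner_add_left cinner_add_right cinner_scaleR_left cinner_scaleR_right
      cinner_Cauchy_Schwarz intro!: exI[of _ 1])

text \<open>The type of operators carries only a real vector space structure. Packaging a complex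
  scalar as an operator makes shifts such as \<open>A - cscale z\<close> expressible in it.\<close>

definition cscale :: "complex \<Rightarrow> 'a::complex_hilbert \<Rightarrow>\<^sub>L 'a" where
  "cscale c = Blinfun (\<lambda>x. c *\<^sub>C x)"

lemma cscale_apply [simp]: "blinfun_apply (cscale c) x = c *\<^sub>C x"
  unfolding cscale_def
  by (subst bounded_linear_Blinfun_apply)
    (auto intro!: bounded_linear_intro[where K = "cmod c"]
      simp: scaleC_add_right scaleC_scaleR_commute norm_scaleC)

section \<open>The algebra of complex-linear bounded operators\<close>

lemma bounded_ops_scaleC: "T \<in> bounded_ops \<Longrightarrow> blinfun_apply T (c *\<^sub>C x) = c *\<^sub>C blinfun_apply T x"
  by (simp add: bounded_ops_def)

lemma bounded_ops_cscale [simp]: "cscale c \<in> bounded_ops"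
  by (simp add: bounded_ops_def scaleC_scaleC mult.commute)

lemma bounded_ops_add: "S \<in> bounded_ops \<Longrightarrow> T \<in> bounded_ops \<Longrightarrow> S + T \<in> bounded_ops"
  by (simp add: bounded_ops_def blinfun.add_left scaleC_add_right)

lemma bounded_ops_diff: "S \<in> bounded_ops \<Longrightarrow> T \<in> bounded_ops \<Longrightarrow> S - T \<in> bounded_ops"
  by (simp add: bounded_ops_def blinfun.diff_left scaleC_diff_right)

lemma bounded_ops_compose: "S \<in> bounded_ops \<Longrightarrow> T \<in> bounded_ops \<Longrightarrow> S o\<^sub>L T \<in> bounded_ops"
  by (simp add: bounded_ops_def)

lemma self_adjoint_bounded_ops: "self_adjoint A \<Longrightarrow> A \<in> bounded_ops"
  by (simp add: self_adjoint_def)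

lemma self_adjoint_cinner:
  "self_adjoint A \<Longrightarrow> cinner (blinfun_apply A x) y = cinner x (blinfun_apply A y)"
  by (simp add: self_adjoint_def is_adjoint_def)

lemma self_adjoint_add: "self_adjoint A \<Longrightarrow> self_adjoint B \<Longrightarrow> self_adjoint (A + B)"
  by (simp add: self_adjoint_def is_adjoint_def bounded_ops_add blinfun.add_left
      cinner_add_left cinner_add_right)

text \<open>Lax-Milgram: \<open>x \<mapsto> x - t (P x - y)\<close> is a contraction for \<open>t = c / L\<^sup>2\<close>, and its fixed point
  solves \<open>P x = y\<close>.\<close>

lemma coercive_invertible:
  fixes P :: "'a::complex_hilbert \<Rightarrow>\<^sub>L 'a"
  assumes P: "P \<in> bounded_ops" and c: "c > 0"
    and coercive: "\<And>x. c * (norm x)\<^sup>2 \<le> Re (cinner (blinfun_apply P x) x)"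
  obtains S where "S \<in> bounded_ops" "\<And>x. blinfun_apply S (blinfun_apply P x) = x"
    "\<And>x. blinfun_apply P (blinfun_apply S x) = x"
proof -
  \<comment> \<open>Adding \<open>c\<close> to the norm makes \<open>L\<close> positive and at least
    \<open>c\<close>, so the squared contraction factor \<open>1 - c\<^sup>2 / L\<^sup>2\<close>
    lies between 0 and 1 and is strictly below 1.\<close>
  define L where "L = norm P + c"
  have L: "L > 0" "c \<le> L" "norm P \<le> L" using c by (auto simp: L_def add_nonneg_pos)
  define t where "t = c / L\<^sup>2"
  have t: "t > 0" using c L by (simp add: t_def)
  define k where "k = sqrt (1 - c\<^sup>2 / L\<^sup>2)"
  have cL: "0 < c\<^sup>2 / L\<^sup>2" "c\<^sup>2 / L\<^sup>2 \<le> 1" using c L by (auto simp: power_mono)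
  have k: "0 \<le> k" "k < 1" "k\<^sup>2 = 1 - c\<^sup>2 / L\<^sup>2" using cL by (auto simp: k_def)
  have contr: "norm (u - t *\<^sub>R blinfun_apply P u) \<le> k * norm u" for u
  proof -
    have "norm (blinfun_apply P u) \<le> L * norm u"
      using norm_blinfun[of P u] mult_right_mono[OF L(3), of "norm u"] by simp
    then have "(norm (blinfun_apply P u))\<^sup>2 \<le> L\<^sup>2 * (norm u)\<^sup>2"
      by (metis norm_ge_zero power_mono power_mult_distrib)
    then have "t\<^sup>2 * (norm (blinfun_apply P u))\<^sup>2 \<le> t\<^sup>2 * (L\<^sup>2 * (norm u)\<^sup>2)"
      by (rule mult_left_mono) simp
    moreover have "t * (c * (norm u)\<^sup>2) \<le> t * Re (cinner (blinfun_apply P u) u)"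
      using coercive t by simp
    moreover have "Re (cinner u (blinfun_apply P u)) = Re (cinner (blinfun_apply P u) u)"
      using arg_cong[OF cinner_commute[of u "blinfun_apply P u"], of Re] by simp
    moreover have "t\<^sup>2 * (L\<^sup>2 * (norm u)\<^sup>2) = c\<^sup>2 / L\<^sup>2 * (norm u)\<^sup>2"
      using L by (simp add: t_def power2_eq_square)
    moreover have "t * (c * (norm u)\<^sup>2) = c\<^sup>2 / L\<^sup>2 * (norm u)\<^sup>2"
      by (simp add: t_def power2_eq_square)
    ultimately have "(norm (u - t *\<^sub>R blinfun_apply P u))\<^sup>2 \<le> (norm u)\<^sup>2 - c\<^sup>2 / L\<^sup>2 * (norm u)\<^sup>2"
      by (simp add: norm_diff_square cinner_scaleR_right power_mult_distrib)
    also have "\<dots> = (k * norm u)\<^sup>2"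
      by (simp add: power_mult_distrib k(3) left_diff_distrib)
    finally show ?thesis
      by (rule power2_le_imp_le) (use k in simp)
  qed
  have surj: "\<exists>x. blinfun_apply P x = y" for y
  proof -
    let ?F = "\<lambda>x. x - t *\<^sub>R (blinfun_apply P x - y)"
    have "dist (?F x) (?F x') \<le> k * dist x x'" for x x'
    proof -
      have "?F x - ?F x' = (x - x') - t *\<^sub>R blinfun_apply P (x - x')"
        by (simp add: blinfun.diff_right algebra_simps)
      then show ?thesis using contr[of "x - x'"] by (simp only: dist_norm)
    qed
    then have "\<exists>!x. ?F x = x"
      using k by (intro banach_fix_type[of k]) auto
    then obtain x where "?F x = x" by auto
    then show ?thesis using t by auto
  qed
  have lower: "c * norm x \<le> norm (blinfun_apply P x)" for x
  proof (cases "x = 0")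
    case False
    have "c * (norm x)\<^sup>2 \<le> norm (blinfun_apply P x) * norm x"
      using coercive[of x] complex_Re_le_cmod[of "cinner (blinfun_apply P x) x"]
        cinner_Cauchy_Schwarz[of "blinfun_apply P x" x] by linarith
    then show ?thesis using False by (simp add: power2_eq_square)
  qed simp
  have inj: "blinfun_apply P x = blinfun_apply P y \<Longrightarrow> x = y" for x y
    using lower[of "x - y"] c by (simp add: blinfun.diff_right mult_le_0_iff)
  \<comment> \<open>The inverse is chosen pointwise. Injectivity of \<open>P\<close> transfers
    linearity from \<open>P\<close> to \<open>R\<close>, and the lower bound on \<open>P\<close>
    becomes the bound \<open>1 / c\<close> on \<open>R\<close>.\<close>
  define R where "R y = (SOME x. blinfun_apply P x = y)" for y
  have PR: "blinfun_apply P (R y) = y" for y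
    unfolding R_def using someI_ex[OF surj] .
  have RP: "R (blinfun_apply P x) = x" for x
    by (rule inj) (rule PR)
  have "bounded_linear R"
  proof (rule bounded_linear_intro[where K = "1 / c"])
    show "R (x + y) = R x + R y" for x y by (rule inj) (simp add: PR blinfun.add_right)
    show "R (r *\<^sub>R x) = r *\<^sub>R R x" for r x by (rule inj) (simp add: PR blinfun.scaleR_right)
    show "norm (R x) \<le> norm x * (1 / c)" for x
      using lower[of "R x"] c by (simp add: PR field_simps)
  qed
  then have R: "blinfun_apply (Blinfun R) = R" by (rule bounded_linear_Blinfun_apply)
  have "R (a *\<^sub>C x) = a *\<^sub>C R x" for a x
    by (rule inj) (simp add: PR bounded_ops_scaleC[OF P])
  then have "Blinfun R \<in> bounded_ops" by (simp add: bounded_ops_def R)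
  then show thesis using that[of "Blinfun R"] by (simp add: R PR RP)
qed

section \<open>Lower bounds and the spectrum\<close>

definition bounded_below :: "('a::real_normed_vector \<Rightarrow>\<^sub>L 'b::real_normed_vector) \<Rightarrow> bool" where
  "bounded_below T \<longleftrightarrow> (\<exists>c>0. \<forall>x. c * norm x \<le> norm (blinfun_apply T x))"

lemma bounded_below_compose:
  assumes "bounded_below S" "bounded_below T"
  shows "bounded_below (S o\<^sub>L T)"
proof -
  obtain c d where cd: "c > 0" "d > 0"
    "\<And>x. c * norm x \<le> norm (blinfun_apply S x)" "\<And>x. d * norm x \<le> norm (blinfun_apply T x)"
    using assms by (auto simp: bounded_below_def)
  have "c * d * norm x \<le> norm (blinfun_apply (S o\<^sub>L T) x)" for x
    using order_trans[OF mult_left_mono[OF cd(4)[of x], of c] cd(3)] cd(1)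
    by (simp add: mult.assoc)
  then show ?thesis
    using cd by (auto simp: bounded_below_def intro!: exI[of _ "c * d"])
qed

lemma is_adjoint_shift:
  assumes "self_adjoint A"
  shows "is_adjoint (A - cscale z) (A - cscale (cnj z))"
  using assms by (simp add: is_adjoint_def blinfun.diff_left cinner_diff_left cinner_diff_right
      self_adjoint_cinner cinner_scaleC_left cinner_scaleC_right)

lemma shift_commute:
  assumes "A \<in> bounded_ops"
  shows "(A - cscale z) o\<^sub>L (A - cscale w) = (A - cscale w) o\<^sub>L (A - cscale z)"
  by (rule blinfun_eqI)
    (simp add: blinfun.diff_left blinfun.diff_right bounded_ops_scaleC[OF assms]
      scaleC_diff_right scaleC_scaleC mult.commute)

text \<open>An inverse always gives a lower bound. Conversely, a lower bound alone yields only
  injectivity and closed range; surjectivity comes from normality of the shift, as it commutes with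
  its adjoint.\<close>

lemma spectrum_iff:
  fixes A :: "'a::complex_hilbert \<Rightarrow>\<^sub>L 'a"
  assumes A: "self_adjoint A"
  shows "z \<in> spectrum A \<longleftrightarrow> \<not> bounded_below (A - cscale z)"
proof
  assume z: "z \<in> spectrum A"
  show "\<not> bounded_below (A - cscale z)"
  proof
    assume "bounded_below (A - cscale z)"
    then obtain c where c: "c > 0" "\<And>x. c * norm x \<le> norm (blinfun_apply (A - cscale z) x)"
      by (auto simp: bounded_below_def)
    \<comment> \<open>\<open>?N\<close> is normal, so it is invertible because the coercive operator \<open>?N' o\<^sub>L ?N\<close> is.\<close>
    let ?N = "A - cscale z" and ?N' = "A - cscale (cnj z)"
    have Ab: "A \<in> bounded_ops" using A by (rule self_adjoint_bounded_ops)
    have Nb: "?N \<in> bounded_ops" "?N' \<in> bounded_ops"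
      using Ab by (auto intro: bounded_ops_diff)
    have comm: "blinfun_apply ?N (blinfun_apply ?N' x) = blinfun_apply ?N' (blinfun_apply ?N x)" for x
      using arg_cong[OF shift_commute[OF Ab, of z "cnj z"], of "\<lambda>T. blinfun_apply T x"] by simp
    have "c\<^sup>2 * (norm x)\<^sup>2 \<le> Re (cinner (blinfun_apply (?N' o\<^sub>L ?N) x) x)" for x
    proof -
      have "cinner (blinfun_apply (?N' o\<^sub>L ?N) x) x = cinner (blinfun_apply ?N x) (blinfun_apply ?N x)"
        using is_adjoint_shift[OF A, of "cnj z"] by (simp add: is_adjoint_def)
      moreover have "(c * norm x)\<^sup>2 \<le> (norm (blinfun_apply ?N x))\<^sup>2"
        using c by (intro power_mono) auto
      ultimately show ?thesis by (simp add: cinner_self power_mult_distrib)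
    qed
    then obtain S where S: "S \<in> bounded_ops"
        "\<And>x. blinfun_apply S (blinfun_apply (?N' o\<^sub>L ?N) x) = x"
        "\<And>x. blinfun_apply (?N' o\<^sub>L ?N) (blinfun_apply S x) = x"
      using coercive_invertible[of "?N' o\<^sub>L ?N" "c\<^sup>2"] c(1) Nb bounded_ops_compose by (metis zero_less_power)
    let ?R = "S o\<^sub>L ?N'"
    have 1: "blinfun_apply ?R (blinfun_apply ?N x) = x" for x
      using S(2)[of x] by simp
    have R: "blinfun_apply ?N (blinfun_apply (?N' o\<^sub>L S) x) = x" for x
      using S(3)[of x] by (simp add: comm)
    \<comment> \<open>\<open>?R\<close> is a left inverse of \<open>?N\<close> and
      \<open>?N' o\<^sub>L S\<close> is a right inverse, so they coincide and the inverse is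
      two-sided.\<close>
    have "blinfun_apply ?R x = blinfun_apply (?N' o\<^sub>L S) x" for x
      using 1[of "blinfun_apply (?N' o\<^sub>L S) x"] by (simp only: R)
    then have 2: "blinfun_apply ?N (blinfun_apply ?R x) = x" for x
      by (simp only: R)
    have "?R \<in> bounded_ops" using S Nb by (intro bounded_ops_compose)
    moreover have "\<forall>x. blinfun_apply ?R (blinfun_apply A x - z *\<^sub>C x) = x \<and>
        blinfun_apply A (blinfun_apply ?R x) - z *\<^sub>C blinfun_apply ?R x = x"
      using 1 2 by (simp only: blinfun.diff_left cscale_apply simp_thms)
    ultimately show False using z unfolding spectrum_def by blast
  qed
next
  assume nb: "\<not> bounded_below (A - cscale z)"
  show "z \<in> spectrum A"
  proof (rule ccontr)
    assume "z \<notin> spectrum A"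
    then obtain S where S: "\<And>x. blinfun_apply S (blinfun_apply A x - z *\<^sub>C x) = x"
      by (auto simp: spectrum_def)
    \<comment> \<open>The summand 1 keeps the denominator positive on the trivial space, where
      \<open>S\<close> is zero.\<close>
    have "1 / (norm S + 1) * norm x \<le> norm (blinfun_apply (A - cscale z) x)" for x
    proof -
      let ?y = "blinfun_apply (A - cscale z) x"
      have "norm x \<le> norm S * norm ?y"
        using norm_blinfun[of S ?y] S[of x] by (simp add: blinfun.diff_left)
      also have "\<dots> \<le> (norm S + 1) * norm ?y" by (intro mult_right_mono) auto
      finally have "norm x \<le> (norm S + 1) * norm ?y" .
      moreover have "norm S + 1 > 0" by (simp add: add_nonneg_pos)
      ultimately show ?thesis by (simp add: field_simps)
    qed
    moreover have "1 / (norm S + 1) > 0" by (simp add: add_nonneg_pos)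
    ultimately show False using nb unfolding bounded_below_def by blast
  qed
qed

text \<open>If the modulus of the quadratic form of \<open>A - z\<close> is at least
  \<open>e\<close> times the squared norm with \<open>e > 0\<close>, then Cauchy-Schwarz makes
  \<open>A - z\<close> bounded below and \<open>z\<close> is not spectral. The numbers
  \<open>\<bar>Im z\<bar>\<close>, \<open>m - Re z\<close> and \<open>Re z - M\<close> all qualify
  as such an \<open>e\<close>, hence none is positive.\<close>

lemma spectrum_real:
  fixes A :: "'a::complex_hilbert \<Rightarrow>\<^sub>L 'a"
  assumes A: "self_adjoint A" and "op_between m A M" and z: "z \<in> spectrum A"
  shows "z = complex_of_real (Re z) \<and> Re z \<in> {m..M}"
proof -
  have bb: "e \<le> 0" if e: "\<And>x. e * (norm x)\<^sup>2 \<le> cmod (cinner (blinfun_apply (A - cscale z) x) x)" for e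
  proof (rule ccontr)
    assume "\<not> e \<le> 0"
    moreover have "e * norm x \<le> norm (blinfun_apply (A - cscale z) x)" for x
    proof (cases "x = 0")
      case False
      have "e * (norm x)\<^sup>2 \<le> norm (blinfun_apply (A - cscale z) x) * norm x"
        using e[of x] cinner_Cauchy_Schwarz order_trans by blast
      then show ?thesis using False by (simp add: power2_eq_square)
    qed simp
    ultimately have "bounded_below (A - cscale z)"
      unfolding bounded_below_def by (metis not_le)
    then show False using spectrum_iff[OF A] z by blast
  qed
  have q: "cinner (blinfun_apply (A - cscale z) x) x = cinner (blinfun_apply A x) x - z * complex_of_real ((norm x)\<^sup>2)" for x
    by (simp add: blinfun.diff_left cinner_diff_left cinner_scaleC_left cinner_self)
  have im: "Im (cinner (blinfun_apply A x) x) = 0" for x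
    using arg_cong[OF cinner_commute[of "blinfun_apply A x" x], of Im]
    by (simp add: self_adjoint_cinner[OF A])
  have bet: "m * (norm x)\<^sup>2 \<le> Re (cinner (blinfun_apply A x) x)"
    "Re (cinner (blinfun_apply A x) x) \<le> M * (norm x)\<^sup>2" for x
    using assms(2) by (auto simp: op_between_def cinner_self)
  have "\<bar>Im z\<bar> \<le> 0"
  proof (rule bb)
    fix x
    have "\<bar>Im z\<bar> * (norm x)\<^sup>2 = \<bar>Im (cinner (blinfun_apply (A - cscale z) x) x)\<bar>"
      by (simp add: q im abs_mult)
    then show "\<bar>Im z\<bar> * (norm x)\<^sup>2 \<le> cmod (cinner (blinfun_apply (A - cscale z) x) x)"
      by (metis abs_Im_le_cmod)
  qed
  moreover have "m - Re z \<le> 0"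
  proof (rule bb)
    fix x
    have "(m - Re z) * (norm x)\<^sup>2 \<le> Re (cinner (blinfun_apply (A - cscale z) x) x)"
      using bet(1)[of x] by (simp add: q left_diff_distrib)
    then show "(m - Re z) * (norm x)\<^sup>2 \<le> cmod (cinner (blinfun_apply (A - cscale z) x) x)"
      using complex_Re_le_cmod order_trans by blast
  qed
  moreover have "Re z - M \<le> 0"
  proof (rule bb)
    fix x
    have "(Re z - M) * (norm x)\<^sup>2 \<le> - Re (cinner (blinfun_apply (A - cscale z) x) x)"
      using bet(2)[of x] by (simp add: q left_diff_distrib)
    then show "(Re z - M) * (norm x)\<^sup>2 \<le> cmod (cinner (blinfun_apply (A - cscale z) x) x)"
      using abs_Re_le_cmod[of "cinner (blinfun_apply (A - cscale z) x) x"] by linarith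
  qed
  ultimately show ?thesis by (simp add: complex_eq_iff)
qed

text \<open>These crude bounds make \<open>spectrum_real\<close> applicable when no \<open>m\<close>
  and \<open>M\<close> are given.\<close>

lemma op_between_norm: "op_between (- norm A) A (norm A)"
proof -
  have "\<bar>Re (cinner (blinfun_apply A x) x)\<bar> \<le> norm A * (norm x)\<^sup>2" for x
  proof -
    have "\<bar>Re (cinner (blinfun_apply A x) x)\<bar> \<le> norm (blinfun_apply A x) * norm x"
      using abs_Re_le_cmod cinner_Cauchy_Schwarz order_trans by blast
    also have "\<dots> \<le> norm A * norm x * norm x"
      by (intro mult_right_mono norm_blinfun) simp
    finally show ?thesis by (simp add: power2_eq_square)
  qed
  then show ?thesis
    by (auto simp: op_between_def cinner_self abs_le_iff minus_le_iff)
qed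

text \<open>A lower bound \<open>c\<close> for \<open>A - z\<close> survives moving \<open>z\<close>
  by less than \<open>c\<close>, so the complement is open. Boundedness comes from the reality of
  the spectrum and the bound by \<open>norm A\<close>.\<close>

lemma compact_spectrum:
  assumes A: "self_adjoint A"
  shows "compact (spectrum A)"
proof -
  have "open (- spectrum A)"
    unfolding open_dist
  proof (intro ballI)
    fix z assume "z \<in> - spectrum A"
    then obtain c where c: "c > 0" "\<And>x. c * norm x \<le> norm (blinfun_apply (A - cscale z) x)"
      by (auto simp: spectrum_iff[OF A] bounded_below_def)
    have "w \<in> - spectrum A" if w: "dist w z < c" for w
    proof -
      have "(c - cmod (w - z)) * norm x \<le> norm (blinfun_apply (A - cscale w) x)" for x
      proof -
        have "(w - z) *\<^sub>C x = w *\<^sub>C x - z *\<^sub>C x"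
          using scaleC_add_left[of "w - z" z x] by simp
        then have "blinfun_apply (A - cscale z) x = blinfun_apply (A - cscale w) x + (w - z) *\<^sub>C x"
          by (simp add: blinfun.diff_left)
        then have "norm (blinfun_apply (A - cscale z) x) \<le> norm (blinfun_apply (A - cscale w) x) + cmod (w - z) * norm x"
          using norm_triangle_ineq[of "blinfun_apply (A - cscale w) x" "(w - z) *\<^sub>C x"]
          by (simp add: norm_scaleC)
        then show ?thesis using c(2)[of x] by (simp add: left_diff_distrib)
      qed
      moreover have "c - cmod (w - z) > 0" using w by (simp add: dist_norm)
      ultimately show ?thesis
        unfolding Compl_iff spectrum_iff[OF A] bounded_below_def by blast
    qed
    then show "\<exists>e>0. \<forall>w. dist w z < e \<longrightarrow> w \<in> - spectrum A" using c(1) by blast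
  qed
  moreover have "bounded (spectrum A)"
    unfolding bounded_iff
  proof (intro exI ballI)
    fix z assume "z \<in> spectrum A"
    from spectrum_real[OF A op_between_norm this]
    have "z = complex_of_real (Re z)" "\<bar>Re z\<bar> \<le> norm A" by auto
    then show "norm z \<le> norm A" by (metis norm_of_real)
  qed
  ultimately show ?thesis by (simp add: compact_eq_bounded_closed closed_def)
qed

section \<open>Polynomials of an operator\<close>

lemma cscale_zero [simp]: "cscale 0 = 0"
  by (rule blinfun_eqI) simp

lemma cscale_one: "cscale 1 = id_blinfun"
  by (rule blinfun_eqI) (simp add: scaleC_one)

lemma cscale_add: "cscale (a + b) = cscale a + cscale b"
  by (rule blinfun_eqI) (simp add: blinfun.add_left scaleC_add_left)

lemma cscale_minus: "cscale (- a) = - cscale a"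
  using cscale_add[of a "- a"] by (simp add: eq_neg_iff_add_eq_0 add.commute)

lemma cscale_compose: "cscale a o\<^sub>L cscale b = cscale (a * b)"
  by (rule blinfun_eqI) (simp add: scaleC_scaleC)

lemma cscale_commute: "T \<in> bounded_ops \<Longrightarrow> T o\<^sub>L cscale a = cscale a o\<^sub>L T"
  by (rule blinfun_eqI) (simp add: bounded_ops_scaleC)

lemma blinfun_compose_add_right: "S o\<^sub>L (T + U) = (S o\<^sub>L T) + (S o\<^sub>L U)"
  by (rule blinfun_eqI) (simp add: blinfun.add_left blinfun.add_right)

lemma blinfun_compose_add_left: "(S + T) o\<^sub>L U = (S o\<^sub>L U) + (T o\<^sub>L U)"
  by (rule blinfun_eqI) (simp add: blinfun.add_left)

lemma blinfun_compose_0_right [simp]: "S o\<^sub>L 0 = 0"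
  by (rule blinfun_eqI) simp

lemma blinfun_compose_0_left [simp]: "0 o\<^sub>L S = 0"
  by (rule blinfun_eqI) simp

lemma blinfun_compose_assoc: "(S o\<^sub>L T) o\<^sub>L U = S o\<^sub>L (T o\<^sub>L U)"
  by (rule blinfun_eqI) simp

lemma is_adjoint_sym: "is_adjoint S T \<Longrightarrow> is_adjoint T S"
  unfolding is_adjoint_def by (metis cinner_commute)

text \<open>This is Horner's scheme, with coefficients entering as scalar operators; it makes
  induction over \<open>pCons\<close> the natural proof method.\<close>

definition op_poly :: "('a::complex_hilbert \<Rightarrow>\<^sub>L 'a) \<Rightarrow> complex poly \<Rightarrow> ('a \<Rightarrow>\<^sub>L 'a)" where
  "op_poly A p = fold_coeffs (\<lambda>a T. cscale a + (A o\<^sub>L T)) p 0"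

lemma op_poly_0 [simp]: "op_poly A 0 = 0"
  by (simp add: op_poly_def)

lemma op_poly_pCons: "op_poly A (pCons a p) = cscale a + (A o\<^sub>L op_poly A p)"
  \<comment> \<open>\<open>pCons 0 0\<close> is the zero polynomial, on which the fold takes no
    step; both sides are then zero.\<close>
  by (cases "p = 0 \<and> a = 0") (auto simp: op_poly_def)

lemma op_poly_const: "op_poly A [:a:] = cscale a"
  by (simp add: op_poly_pCons)

lemma op_poly_linear: "op_poly A [:a, 1:] = A + cscale a"
  by (rule blinfun_eqI) (simp add: op_poly_pCons cscale_one blinfun.add_left)

lemma op_poly_add: "op_poly A (p + q) = op_poly A p + op_poly A q"
  by (induction p q rule: poly_induct2)
    (auto simp: op_poly_pCons cscale_add blinfun_compose_add_right)

context
  fixes A :: "'a::complex_hilbert \<Rightarrow>\<^sub>L 'a"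
  assumes A_bounded: "A \<in> bounded_ops"
begin

lemma op_poly_smult: "op_poly A (smult c p) = cscale c o\<^sub>L op_poly A p"
proof (induction p)
  case (pCons a p)
  have "A o\<^sub>L (cscale c o\<^sub>L op_poly A p) = cscale c o\<^sub>L (A o\<^sub>L op_poly A p)"
    by (metis A_bounded cscale_commute blinfun_compose_assoc)
  with pCons show ?case
    by (simp add: op_poly_pCons cscale_compose blinfun_compose_add_right)
qed simp

lemma op_poly_diff: "op_poly A (p - q) = op_poly A p - op_poly A q"
  using op_poly_add[of A "p - q" q] by simp

lemma op_poly_mult: "op_poly A (p * q) = op_poly A p o\<^sub>L op_poly A q"
proof (induction p)
  case (pCons a p)
  then show ?case
    by (simp add: op_poly_add op_poly_smult op_poly_pCons blinfun_compose_add_left blinfun_compose_assoc)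
qed simp

lemma op_poly_commute: "op_poly A p o\<^sub>L op_poly A q = op_poly A q o\<^sub>L op_poly A p"
  by (metis mult.commute op_poly_mult)

text \<open>Over the complex numbers \<open>op_poly A q\<close> is a nonzero scalar times a product
  of shifts of \<open>A\<close>, each bounded below. It is used in contrapositive form: if
  \<open>op_poly A q\<close> is not bounded below, some root of \<open>q\<close> is
  spectral.\<close>

lemma op_poly_bounded_below:
  assumes "q \<noteq> 0" "\<And>z. poly q z = 0 \<Longrightarrow> bounded_below (A - cscale z)"
  shows "bounded_below (op_poly A q)"
proof -
  obtain R where R: "q = smult (lead_coeff q) (\<Prod>x\<in>#R. [:- x, 1:])"
    using alg_closed_imp_factorization[OF assms(1)] by blast
  \<comment> \<open>Inducting over submultisets of \<open>R\<close> keeps the information that every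
    factor belongs to a root of \<open>q\<close>.\<close>
  have "bounded_below (op_poly A (\<Prod>x\<in>#R'. [:- x, 1:]))" if "R' \<subseteq># R" for R'
    using that
  proof (induction R')
    case empty
    show ?case
      by (auto simp: one_pCons op_poly_const cscale_one bounded_below_def intro!: exI[of _ 1])
  next
    case (add z R')
    have "z \<in># R" using add.prems mset_subset_eqD by fastforce
    then have "[:- z, 1:] dvd (\<Prod>x\<in>#R. [:- x, 1:])"
      by (intro dvd_prod_mset) auto
    then have "poly q z = 0"
      by (subst R) (simp add: poly_eq_0_iff_dvd)
    then have "bounded_below (op_poly A [:- z, 1:])"
      using assms(2)[of z] by (simp add: op_poly_linear cscale_minus)
    moreover have "bounded_below (op_poly A (\<Prod>x\<in>#R'. [:- x, 1:]))"
      using add by (meson mset_subset_eq_insertD subset_mset.less_imp_le)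
    ultimately show ?case
      by (simp only: image_mset_add_mset prod_mset.add_mset op_poly_mult bounded_below_compose)
  qed
  then have "bounded_below (op_poly A (\<Prod>x\<in>#R. [:- x, 1:]))" by simp
  moreover have "bounded_below (cscale (lead_coeff q) :: 'a \<Rightarrow>\<^sub>L 'a)"
    using assms(1) by (auto simp: bounded_below_def norm_scaleC intro!: exI[of _ "cmod (lead_coeff q)"])
  ultimately show ?thesis
    by (subst R) (simp only: op_poly_smult bounded_below_compose)
qed

end

lemma op_poly_adjoint:
  fixes A :: "'a::complex_hilbert \<Rightarrow>\<^sub>L 'a"
  assumes A: "self_adjoint A"
  shows "is_adjoint (op_poly A p) (op_poly A (map_poly cnj p))"
proof (induction p)
  case 0
  show ?case by (simp add: is_adjoint_def)
next
  case (pCons a p)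
  have Ab: "A \<in> bounded_ops" using A by (rule self_adjoint_bounded_ops)
  have "op_poly A [:0, 1:] = A" by (simp add: op_poly_linear)
  \<comment> \<open>Taking adjoints reverses the order of \<open>A\<close> and the polynomial in the
    Horner step, so the two must be exchanged.\<close>
  then have "blinfun_apply (op_poly A q) (blinfun_apply A y) = blinfun_apply A (blinfun_apply (op_poly A q) y)" for q y
    using op_poly_commute[OF Ab, of q "[:0, 1:]"] by (metis blinfun_apply_blinfun_compose)
  with pCons.IH show ?case
    by (simp add: is_adjoint_def map_poly_pCons op_poly_pCons blinfun.add_left cinner_add_left
        cinner_add_right cinner_scaleC_left cinner_scaleC_right self_adjoint_cinner[OF A])
qed

text \<open>Squaring a lower bound \<open>c\<close> for \<open>r\<^sup>2 - T' T\<close>, where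
  \<open>r = norm T\<close>, and using normality would give \<open>(norm (T x))\<^sup>2 \<le>
  (r\<^sup>2 - c\<^sup>2 / r\<^sup>2) * (norm x)\<^sup>2\<close>, so that \<open>norm T < r\<close>.
  The nonzero vector excludes the trivial space, where every operator is bounded below.\<close>

lemma normal_not_bounded_below:
  fixes T T' :: "'a::complex_hilbert \<Rightarrow>\<^sub>L 'a"
  assumes adj: "is_adjoint T T'" and comm: "T o\<^sub>L T' = T' o\<^sub>L T" and x0: "(x0::'a) \<noteq> 0"
  shows "\<not> bounded_below (cscale (complex_of_real ((norm T)\<^sup>2)) - (T' o\<^sub>L T))"
proof
  define r where "r = norm T"
  assume "bounded_below (cscale (complex_of_real ((norm T)\<^sup>2)) - (T' o\<^sub>L T))"
  then obtain c where c: "c > 0"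
    "\<And>x. c * norm x \<le> norm (r\<^sup>2 *\<^sub>R x - blinfun_apply T' (blinfun_apply T x))"
    by (auto simp: bounded_below_def blinfun.diff_left scaleR_eq_scaleC r_def)
  have adj1: "cinner (blinfun_apply T x) y = cinner x (blinfun_apply T' y)" for x y
    using adj by (simp add: is_adjoint_def)
  have adj2: "cinner (blinfun_apply T' x) y = cinner x (blinfun_apply T y)" for x y
    using is_adjoint_sym[OF adj] by (simp add: is_adjoint_def)
  \<comment> \<open>Normality enters here; it turns the norm of \<open>T' T x\<close> into that of
    \<open>T T x\<close>, which is at most \<open>r\<close> times the norm of
    \<open>T x\<close>.\<close>
  have norm_adj: "norm (blinfun_apply T' u) = norm (blinfun_apply T u)" for u
  proof -
    have "cinner (blinfun_apply T' u) (blinfun_apply T' u) = cinner (blinfun_apply (T o\<^sub>L T') u) u"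
      by (simp add: adj1)
    also have "\<dots> = cinner (blinfun_apply T u) (blinfun_apply T u)"
      unfolding comm by (simp add: adj2)
    finally show ?thesis by (simp add: norm_eq_sqrt_cinner)
  qed
  have bound: "c\<^sup>2 * (norm x)\<^sup>2 \<le> r\<^sup>2 * (r\<^sup>2 * (norm x)\<^sup>2 - (norm (blinfun_apply T x))\<^sup>2)" for x
  proof -
    let ?y = "blinfun_apply T x"
    have "(c * norm x)\<^sup>2 \<le> (norm (r\<^sup>2 *\<^sub>R x - blinfun_apply T' ?y))\<^sup>2"
      using c by (intro power_mono) auto
    also have "\<dots> = r\<^sup>2 * r\<^sup>2 * (norm x)\<^sup>2 - 2 * (r\<^sup>2 * (norm ?y)\<^sup>2) + (norm (blinfun_apply T ?y))\<^sup>2"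
      by (simp add: norm_diff_square cinner_scaleR_left norm_adj cinner_self power_mult_distrib
          blinfun.scaleR_right flip: adj1)
    also have "(norm (blinfun_apply T ?y))\<^sup>2 \<le> r\<^sup>2 * (norm ?y)\<^sup>2"
      using power_mono[OF norm_blinfun[of T ?y], of 2] by (simp add: power_mult_distrib r_def)
    finally show ?thesis by (simp add: power_mult_distrib right_diff_distrib)
  qed
  have "r \<noteq> 0"
  proof
    assume "r = 0"
    then show False using bound[of x0] c x0 by (simp add: mult_le_0_iff)
  qed
  then have r: "r > 0" by (simp add: r_def)
  have le: "(norm (blinfun_apply T x))\<^sup>2 \<le> (r\<^sup>2 - c\<^sup>2 / r\<^sup>2) * (norm x)\<^sup>2" for x
    using bound[of x] r by (simp add: field_simps)
  have nonneg: "0 \<le> r\<^sup>2 - c\<^sup>2 / r\<^sup>2"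
    using order_trans[OF zero_le_power2 le[of x0]] x0 by (simp add: zero_le_mult_iff)
  have "norm T \<le> sqrt (r\<^sup>2 - c\<^sup>2 / r\<^sup>2)"
  proof (rule norm_blinfun_bound)
    fix x
    show "norm (blinfun_apply T x) \<le> sqrt (r\<^sup>2 - c\<^sup>2 / r\<^sup>2) * norm x"
      by (rule power2_le_imp_le) (use le[of x] nonneg in \<open>auto simp: power_mult_distrib\<close>)
  qed (use nonneg in simp)
  also have "\<dots> < r"
    using r c by (intro real_less_lsqrt) auto
  finally show False by (simp add: r_def)
qed

lemma spectrum_of_real_Re:
  assumes "self_adjoint A" "z \<in> spectrum A"
  shows "complex_of_real (Re z) = z"
  using spectrum_real[OF assms(1) op_between_norm assms(2)] by simp

lemma norm_op_poly_attained:
  fixes A :: "'a::complex_hilbert \<Rightarrow>\<^sub>L 'a"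
  assumes A: "self_adjoint A" and x0: "(x0::'a) \<noteq> 0"
  shows "\<exists>z\<in>spectrum A. norm (op_poly A p) = cmod (poly p z)"
proof -
  have Ab: "A \<in> bounded_ops" using A by (rule self_adjoint_bounded_ops)
  define q where "q p = [:complex_of_real ((norm (op_poly A p))\<^sup>2):] - map_poly cnj p * p" for p
  have root: "norm (op_poly A p) = cmod (poly p z)" if "poly (q p) z = 0" "z \<in> spectrum A" for p z
  proof -
    \<comment> \<open>Conjugating the coefficients conjugates the value only at real points, so the
      reality of the spectrum is essential.\<close>
    have "cnj z = z" using spectrum_of_real_Re[OF A that(2)] by (metis complex_cnj_complex_of_real)
    then have "poly (map_poly cnj p) z = cnj (poly p z)" by (metis poly_cnj)
    then have "complex_of_real ((norm (op_poly A p))\<^sup>2) = complex_of_real ((cmod (poly p z))\<^sup>2)"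
      using that(1) by (simp add: q_def mult.commute flip: complex_norm_square)
    then have "(norm (op_poly A p))\<^sup>2 = (cmod (poly p z))\<^sup>2"
      using of_real_eq_iff by blast
    then show ?thesis by (simp add: power2_eq_iff_nonneg)
  qed
  have ex_root: "\<exists>z\<in>spectrum A. poly (q p) z = 0" if "q p \<noteq> 0" for p
  proof -
    have "op_poly A (q p) = cscale (complex_of_real ((norm (op_poly A p))\<^sup>2)) - (op_poly A (map_poly cnj p) o\<^sub>L op_poly A p)"
      by (simp only: q_def op_poly_diff[OF Ab] op_poly_mult[OF Ab] op_poly_const)
    then have "\<not> bounded_below (op_poly A (q p))"
      using normal_not_bounded_below[OF op_poly_adjoint[OF A] op_poly_commute[OF Ab] x0] by metis
    then show ?thesis
      using op_poly_bounded_below[OF Ab that] spectrum_iff[OF A] by blast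
  qed
  \<comment> \<open>If \<open>q p = 0\<close> then every point of the spectrum will do; \<open>q [:0, 1:]\<close> shows that there is one.\<close>
  have "q [:0, 1:] \<noteq> 0"
  proof -
    \<comment> \<open>For the identity polynomial \<open>X\<close>, \<open>q\<close> is the constant
      \<open>(norm A)\<^sup>2\<close> minus the square of \<open>X\<close>.\<close>
    have "coeff (q [:0, 1:]) 2 = -1"
      by (simp add: q_def map_poly_pCons coeff_pCons numeral_2_eq_2)
    then show ?thesis by auto
  qed
  then have "\<exists>z\<in>spectrum A. poly (q p) z = 0"
    using ex_root[of "[:0, 1:]"] ex_root[of p] by (cases "q p = 0") auto
  then show ?thesis using root by blast
qed

text \<open>On the trivial space the spectrum is empty and the bound on it says nothing, whence the
  separate case and the assumption \<open>0 \<le> c\<close>.\<close>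

lemma norm_op_poly_le:
  fixes A :: "'a::complex_hilbert \<Rightarrow>\<^sub>L 'a"
  assumes A: "self_adjoint A" and c: "0 \<le> c" "\<And>z. z \<in> spectrum A \<Longrightarrow> cmod (poly p z) \<le> c"
  shows "norm (op_poly A p) \<le> c"
proof (cases "\<exists>x::'a. x \<noteq> 0")
  case True
  then show ?thesis using norm_op_poly_attained[OF A] c by metis
next
  case False
  then have "op_poly A p = 0" by (intro blinfun_eqI) auto
  then show ?thesis using c by simp
qed

section \<open>The continuous functional calculus\<close>

lemma complex_poly_approx_real:
  fixes u :: "real \<Rightarrow> real"
  assumes "compact S" "continuous_on S u" "0 < e"
  obtains p :: "complex poly" where "\<And>t. t \<in> S \<Longrightarrow> cmod (poly p (complex_of_real t) - complex_of_real (u t)) < e"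
proof -
  obtain g where g: "real_polynomial_function g" "\<And>x. x \<in> S \<Longrightarrow> \<bar>u x - g x\<bar> < e"
    using Stone_Weierstrass_real_polynomial_function[OF assms] by blast
  then obtain a n where an: "g = (\<lambda>x. \<Sum>i\<le>n. a i * x ^ i)"
    by (auto simp: real_polynomial_function_iff_sum)
  define p where "p = (\<Sum>i\<le>n. monom (complex_of_real (a i)) i)"
  have "poly p (complex_of_real t) = complex_of_real (g t)" for t
    by (simp add: p_def an poly_sum poly_monom)
  then have "cmod (poly p (complex_of_real t) - complex_of_real (u t)) < e" if "t \<in> S" for t
    using g(2)[OF that] by (metis abs_minus_commute norm_of_real of_real_diff)
  then show thesis by (rule that)
qed

text \<open>Since \<open>S\<close> lies on the real line, the real and imaginary parts of
  \<open>g\<close> are functions of a real variable and can be approximated separately; on a general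
  compact subset of the plane polynomials in \<open>z\<close> alone would not suffice.\<close>

lemma complex_poly_approx:
  fixes g :: "complex \<Rightarrow> complex"
  assumes S: "compact S" "\<And>z. z \<in> S \<Longrightarrow> complex_of_real (Re z) = z"
    and g: "continuous_on S g"
  shows "\<exists>P. uniform_limit S (\<lambda>n. poly (P n)) g sequentially"
proof -
  have "\<exists>p. \<forall>z\<in>S. dist (poly p z) (g z) < e" if e: "e > 0" for e
  proof -
    have cpt: "compact (Re ` S)"
      by (intro compact_continuous_image continuous_intros S)
    have sub: "complex_of_real ` Re ` S \<subseteq> S" using S(2) by auto
    have cont: "continuous_on (Re ` S) (\<lambda>t. g (complex_of_real t))"
      by (rule continuous_on_compose2[OF g _ sub]) (intro continuous_intros)
    obtain p where p: "\<And>t. t \<in> Re ` S \<Longrightarrow>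
        cmod (poly p (complex_of_real t) - complex_of_real (Re (g (complex_of_real t)))) < e / 2"
      by (rule complex_poly_approx_real[OF cpt continuous_on_Re[OF cont], of "e / 2"]) (use e in auto)
    obtain p' where p': "\<And>t. t \<in> Re ` S \<Longrightarrow>
        cmod (poly p' (complex_of_real t) - complex_of_real (Im (g (complex_of_real t)))) < e / 2"
      by (rule complex_poly_approx_real[OF cpt continuous_on_Im[OF cont], of "e / 2"]) (use e in auto)
    have "dist (poly (p + smult \<i> p') z) (g z) < e" if "z \<in> S" for z
    proof -
      have "poly (p + smult \<i> p') z - g z =
          (poly p z - complex_of_real (Re (g z))) + \<i> * (poly p' z - complex_of_real (Im (g z)))"
        by (simp add: algebra_simps complex_eq_iff)
      also have "cmod \<dots> < e / 2 + e / 2"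
        using p[of "Re z"] p'[of "Re z"] that
        by (intro norm_triangle_lt add_strict_mono) (auto simp: S(2) norm_mult)
      finally show ?thesis by (simp add: dist_norm)
    qed
    then show ?thesis by blast
  qed
  then have "\<exists>P. \<forall>n. \<forall>z\<in>S. dist (poly (P n) z) (g z) < inverse (real (Suc n))"
    by (intro choice) auto
  then obtain P where P: "\<And>n z. z \<in> S \<Longrightarrow> dist (poly (P n) z) (g z) < inverse (real (Suc n))"
    by blast
  have "uniform_limit S (\<lambda>n. poly (P n)) g sequentially"
  proof (rule uniform_limitI)
    fix e :: real assume "e > 0"
    then have "\<forall>\<^sub>F n in sequentially. inverse (real (Suc n)) < e"
      using LIMSEQ_inverse_real_of_nat by (rule order_tendstoD(2)[rotated])
    then show "\<forall>\<^sub>F n in sequentially. \<forall>z\<in>S. dist (poly (P n) z) (g z) < e"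
      by eventually_elim (use P in \<open>auto intro: less_trans\<close>)
  qed
  then show ?thesis by blast
qed

text \<open>An arbitrary approximating sequence is picked; \<open>calculus_tendsto\<close> shows
  that the limit does not depend on it.\<close>

definition calculus :: "('a::complex_hilbert \<Rightarrow>\<^sub>L 'a) \<Rightarrow> (complex \<Rightarrow> complex) \<Rightarrow> ('a \<Rightarrow>\<^sub>L 'a)" where
  "calculus A g = lim (\<lambda>n. op_poly A ((SOME P. uniform_limit (spectrum A) (\<lambda>n. poly (P n)) g sequentially) n))"

context
  fixes A :: "'a::complex_hilbert \<Rightarrow>\<^sub>L 'a"
  assumes A: "self_adjoint A"
begin

lemma spectrum_approx:
  assumes "continuous_on (spectrum A) g"
  shows "\<exists>P. uniform_limit (spectrum A) (\<lambda>n. poly (P n)) g sequentially"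
  using complex_poly_approx[OF compact_spectrum[OF A] _ assms] spectrum_of_real_Re[OF A] by blast

text \<open>This serves twice: for one approximating sequence it gives the Cauchy property, for two
  it shows that their limits agree.\<close>

lemma norm_op_poly_diff_le:
  assumes "0 < e" "\<forall>z\<in>spectrum A. dist (poly p z) (g z) < e / 2" "\<forall>z\<in>spectrum A. dist (poly q z) (g z) < e / 2"
  shows "norm (op_poly A p - op_poly A q) \<le> e"
proof -
  have "norm (op_poly A (p - q)) \<le> e"
  proof (rule norm_op_poly_le[OF A])
    fix z assume "z \<in> spectrum A"
    then have "dist (poly p z) (poly q z) < e"
      using assms(2,3) by (metis dist_triangle_half_l dist_commute)
    then show "cmod (poly (p - q) z) \<le> e" by (simp add: dist_norm)
  qed (use assms in simp)
  then show ?thesis by (simp add: op_poly_diff[OF self_adjoint_bounded_ops[OF A]])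
qed

lemma op_poly_convergent:
  assumes P: "uniform_limit (spectrum A) (\<lambda>n. poly (P n)) g sequentially"
  shows "convergent (\<lambda>n. op_poly A (P n))"
proof (intro Cauchy_convergent CauchyI)
  fix e :: real assume e: "e > 0"
  \<comment> \<open>The second halving turns the weak bound \<open>e / 2\<close> from
    \<open>norm_op_poly_diff_le\<close> into the strict bound \<open>e\<close>.\<close>
  then obtain N where N: "\<And>n. n \<ge> N \<Longrightarrow> \<forall>z\<in>spectrum A. dist (poly (P n) z) (g z) < e / 2 / 2"
    using uniform_limitD[OF P, of "e / 2 / 2"] by (auto simp: eventually_sequentially)
  have "norm (op_poly A (P m) - op_poly A (P n)) < e" if "m \<ge> N" "n \<ge> N" for m n
    using norm_op_poly_diff_le[OF _ N[OF that(1)] N[OF that(2)]] e by simp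
  then show "\<exists>N. \<forall>m\<ge>N. \<forall>n\<ge>N. norm (op_poly A (P m) - op_poly A (P n)) < e" by blast
qed

text \<open>Freedom in the choice of \<open>P\<close> lets the laws of the calculus be read off from
  polynomials: one combines sequences for \<open>g\<close> and \<open>h\<close> and passes to the
  limit.\<close>

lemma calculus_tendsto:
  assumes P: "uniform_limit (spectrum A) (\<lambda>n. poly (P n)) g sequentially"
  shows "(\<lambda>n. op_poly A (P n)) \<longlonglongrightarrow> calculus A g"
proof -
  define Q where "Q = (SOME P. uniform_limit (spectrum A) (\<lambda>n. poly (P n)) g sequentially)"
  have Q: "uniform_limit (spectrum A) (\<lambda>n. poly (Q n)) g sequentially"
    unfolding Q_def
    by (rule someI[of "\<lambda>P. uniform_limit (spectrum A) (\<lambda>n. poly (P n)) g sequentially", OF P])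
  have Q_lim: "(\<lambda>n. op_poly A (Q n)) \<longlonglongrightarrow> calculus A g"
    using op_poly_convergent[OF Q] by (simp add: calculus_def convergent_LIMSEQ_iff flip: Q_def)
  have "(\<lambda>n. op_poly A (P n) - op_poly A (Q n)) \<longlonglongrightarrow> 0"
  proof (rule tendstoI)
    fix e :: real assume e: "e > 0"
    then have e4: "e / 2 / 2 > 0" by simp
    show "\<forall>\<^sub>F n in sequentially. dist (op_poly A (P n) - op_poly A (Q n)) 0 < e"
      using uniform_limitD[OF P e4] uniform_limitD[OF Q e4]
    proof eventually_elim
      case (elim n)
      from norm_op_poly_diff_le[OF _ elim] e show ?case by simp
    qed
  qed
  from tendsto_add[OF this Q_lim] show ?thesis by simp
qed

section \<open>Algebraic laws and continuity of the calculus\<close>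

lemma calculus_poly: "calculus A (poly p) = op_poly A p"
  using calculus_tendsto[of "\<lambda>_. p" "poly p"] by (simp add: LIMSEQ_const_iff uniform_limit_const)

lemma calculus_norm_le:
  assumes g: "continuous_on (spectrum A) g" and c: "0 \<le> c" "\<And>z. z \<in> spectrum A \<Longrightarrow> cmod (g z) \<le> c"
  shows "norm (calculus A g) \<le> c"
proof (rule field_le_epsilon)
  fix e :: real assume e: "e > 0"
  obtain P where P: "uniform_limit (spectrum A) (\<lambda>n. poly (P n)) g sequentially"
    using spectrum_approx[OF g] by blast
  have "\<forall>\<^sub>F n in sequentially. norm (op_poly A (P n)) \<le> c + e"
    using uniform_limitD[OF P e]
  proof eventually_elim
    case (elim n)
    show ?case
    proof (rule norm_op_poly_le[OF A])
      fix z assume z: "z \<in> spectrum A"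
      have "cmod (poly (P n) z) \<le> cmod (g z) + dist (poly (P n) z) (g z)"
        by (metis dist_norm norm_triangle_sub)
      then show "cmod (poly (P n) z) \<le> c + e" using c(2)[OF z] elim z by fastforce
    qed (use c e in simp)
  qed
  then show "norm (calculus A g) \<le> c + e"
    by (intro tendsto_upperbound[OF tendsto_norm[OF calculus_tendsto[OF P]]]) auto
qed

lemma calculus_cong:
  assumes "continuous_on (spectrum A) g" "\<And>z. z \<in> spectrum A \<Longrightarrow> g z = h z"
  shows "calculus A g = calculus A h"
proof -
  obtain P where P: "uniform_limit (spectrum A) (\<lambda>n. poly (P n)) g sequentially"
    using spectrum_approx[OF assms(1)] by blast
  moreover have "uniform_limit (spectrum A) (\<lambda>n. poly (P n)) h sequentially"
    using P assms(2) by (simp cong: uniform_limit_cong')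
  ultimately show ?thesis using calculus_tendsto LIMSEQ_unique by blast
qed

lemma calculus_add:
  assumes "continuous_on (spectrum A) g" "continuous_on (spectrum A) h"
  shows "calculus A (\<lambda>z. g z + h z) = calculus A g + calculus A h"
proof -
  obtain P Q where P: "uniform_limit (spectrum A) (\<lambda>n. poly (P n)) g sequentially"
    and Q: "uniform_limit (spectrum A) (\<lambda>n. poly (Q n)) h sequentially"
    using assms[THEN spectrum_approx] by blast
  have "uniform_limit (spectrum A) (\<lambda>n. poly (P n + Q n)) (\<lambda>z. g z + h z) sequentially"
    using uniform_limit_add[OF P Q] unfolding poly_add[symmetric] .
  from calculus_tendsto[OF this] show ?thesis
    using tendsto_add[OF calculus_tendsto[OF P] calculus_tendsto[OF Q]]
    by (simp add: op_poly_add LIMSEQ_unique)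
qed

lemma calculus_mult:
  assumes "continuous_on (spectrum A) g" "continuous_on (spectrum A) h"
  shows "calculus A (\<lambda>z. g z * h z) = calculus A g o\<^sub>L calculus A h"
proof -
  obtain P Q where P: "uniform_limit (spectrum A) (\<lambda>n. poly (P n)) g sequentially"
    and Q: "uniform_limit (spectrum A) (\<lambda>n. poly (Q n)) h sequentially"
    using assms[THEN spectrum_approx] by blast
  \<comment> \<open>Products of uniform limits converge uniformly when the limits are bounded, which
    compactness of the spectrum provides.\<close>
  have "bounded (k ` spectrum A)" if "continuous_on (spectrum A) k" for k :: "complex \<Rightarrow> complex"
    by (intro compact_imp_bounded compact_continuous_image that compact_spectrum A)
  then have "uniform_limit (spectrum A) (\<lambda>n. poly (P n * Q n)) (\<lambda>z. g z * h z) sequentially"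
    using uniform_lim_mult[OF P Q] assms unfolding poly_mult[symmetric] by blast
  from calculus_tendsto[OF this] show ?thesis
    using bounded_bilinear.tendsto[OF bounded_bilinear_blinfun_compose calculus_tendsto[OF P] calculus_tendsto[OF Q]]
    by (simp add: op_poly_mult[OF self_adjoint_bounded_ops[OF A]] LIMSEQ_unique)
qed

lemma calculus_const: "calculus A (\<lambda>z. c) = cscale c"
proof -
  have "poly [:c:] = (\<lambda>z. c)" by auto
  then show ?thesis using calculus_poly[of "[:c:]"] by (simp add: op_poly_const)
qed

lemma calculus_ident: "calculus A (\<lambda>z. z) = A"
proof -
  have "poly [:0, 1:] = (\<lambda>z::complex. z)" by auto
  then show ?thesis using calculus_poly[of "[:0, 1:]"] by (simp add: op_poly_linear)
qed

lemma calculus_cmult: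
  assumes "continuous_on (spectrum A) g"
  shows "calculus A (\<lambda>z. c * g z) = cscale c o\<^sub>L calculus A g"
  using calculus_mult[of "\<lambda>z. c" g] assms by (simp add: calculus_const)

lemma calculus_diff:
  assumes "continuous_on (spectrum A) g" "continuous_on (spectrum A) h"
  shows "calculus A (\<lambda>z. g z - h z) = calculus A g - calculus A h"
  using calculus_add[of "\<lambda>z. g z - h z" h] assms by (simp add: continuous_on_diff)

text \<open>Complex linearity is commutation with \<open>cscale c\<close>, which follows from
  multiplicativity because \<open>g\<close> commutes with constant functions.\<close>

lemma calculus_bounded_ops:
  assumes "continuous_on (spectrum A) g"
  shows "calculus A g \<in> bounded_ops"
proof -
  have "calculus A g o\<^sub>L cscale c = cscale c o\<^sub>L calculus A g" for c
    using calculus_mult[of "\<lambda>z. c" g] calculus_mult[of g "\<lambda>z. c"] assms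
    by (simp add: calculus_const mult.commute)
  from arg_cong[OF this, of "\<lambda>T. blinfun_apply T x" for x] show ?thesis
    by (simp add: bounded_ops_def)
qed

lemma calculus_adjoint:
  assumes "continuous_on (spectrum A) g"
  shows "is_adjoint (calculus A g) (calculus A (\<lambda>z. cnj (g z)))"
  unfolding is_adjoint_def
proof (intro allI)
  fix x y
  obtain P where P: "uniform_limit (spectrum A) (\<lambda>n. poly (P n)) g sequentially"
    using spectrum_approx[OF assms] by blast
  have "poly (map_poly cnj p) z = cnj (poly p z)" if "z \<in> spectrum A" for p z
    using spectrum_of_real_Re[OF A that] by (metis complex_cnj_complex_of_real poly_cnj)
  \<comment> \<open>On the real spectrum the polynomials with conjugated coefficients approximate
    the conjugate of \<open>g\<close>; the adjoint relation then passes to the limit in the inner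
    product.\<close>
  then have "uniform_limit (spectrum A) (\<lambda>n. poly (map_poly cnj (P n))) (\<lambda>z. cnj (g z)) sequentially"
    using P by (simp add: uniform_limit_iff dist_norm flip: complex_cnj_diff)
  note lims = calculus_tendsto[OF P] calculus_tendsto[OF this]
  have apply_lim: "(\<lambda>n. blinfun_apply (T n) v) \<longlonglongrightarrow> blinfun_apply S v" if "T \<longlonglongrightarrow> S"
    for T and S :: "'a \<Rightarrow>\<^sub>L 'a" and v
    by (intro blinfun.tendsto that tendsto_const)
  note cin = bounded_bilinear.tendsto[OF bounded_bilinear_cinner]
  have "(\<lambda>n. cinner (blinfun_apply (op_poly A (P n)) x) y) \<longlonglongrightarrow> cinner (blinfun_apply (calculus A g) x) y"
    by (intro cin apply_lim lims tendsto_const)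
  moreover have "(\<lambda>n. cinner x (blinfun_apply (op_poly A (map_poly cnj (P n))) y)) \<longlonglongrightarrow>
      cinner x (blinfun_apply (calculus A (\<lambda>z. cnj (g z))) y)"
    by (intro cin apply_lim lims tendsto_const)
  ultimately show "cinner (blinfun_apply (calculus A g) x) y = cinner x (blinfun_apply (calculus A (\<lambda>z. cnj (g z))) y)"
    using op_poly_adjoint[OF A] by (simp add: is_adjoint_def LIMSEQ_unique)
qed

lemma calculus_continuous:
  assumes g: "continuous_on (spectrum A) g" and G: "\<And>n. continuous_on (spectrum A) (G n)"
    and lim: "uniform_limit (spectrum A) G g sequentially"
  shows "(\<lambda>n. calculus A (G n)) \<longlonglongrightarrow> calculus A g"
proof (rule tendstoI)
  fix e :: real assume "e > 0"
  then have e2: "e / 2 > 0" by simp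
  show "\<forall>\<^sub>F n in sequentially. dist (calculus A (G n)) (calculus A g) < e"
    using uniform_limitD[OF lim e2]
  proof eventually_elim
    case (elim n)
    have "norm (calculus A (\<lambda>z. G n z - g z)) \<le> e / 2"
      using elim e2 by (intro calculus_norm_le continuous_on_diff G g) (auto simp: dist_norm less_imp_le)
    then show ?case using e2 by (simp add: calculus_diff G g dist_norm)
  qed
qed

section \<open>Existence and uniqueness of the functional calculus\<close>

lemma is_functional_calculus_calculus: "is_functional_calculus A (calculus A)"
  unfolding is_functional_calculus_def Let_def
proof (intro conjI)
  let ?C = "{g. continuous_on (spectrum A) g}"
  show "\<forall>g\<in>?C. calculus A g \<in> bounded_ops"
    using calculus_bounded_ops by blast
  show "\<forall>g\<in>?C. \<forall>h\<in>?C. (\<forall>z\<in>spectrum A. g z = h z) \<longrightarrow> calculus A g = calculus A h"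
    using calculus_cong by blast
  show "\<forall>g\<in>?C. \<forall>h\<in>?C. calculus A (\<lambda>z. g z + h z) = calculus A g + calculus A h"
    using calculus_add by blast
  show "\<forall>g\<in>?C. \<forall>c x. blinfun_apply (calculus A (\<lambda>z. c * g z)) x = c *\<^sub>C blinfun_apply (calculus A g) x"
    by (simp add: calculus_cmult)
  show "\<forall>g\<in>?C. \<forall>h\<in>?C. calculus A (\<lambda>z. g z * h z) = calculus A g o\<^sub>L calculus A h"
    using calculus_mult by blast
  show "\<forall>g\<in>?C. is_adjoint (calculus A g) (calculus A (\<lambda>z. cnj (g z)))"
    using calculus_adjoint by blast
  show "calculus A (\<lambda>z. 1) = id_blinfun"
    by (simp only: calculus_const cscale_one)
  show "calculus A (\<lambda>z. z) = A"
    by (rule calculus_ident)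
  show "\<forall>G. \<forall>g\<in>?C. (\<forall>n::nat. G n \<in> ?C) \<and> uniform_limit (spectrum A) G g sequentially \<longrightarrow>
      (\<lambda>n. calculus A (G n)) \<longlonglongrightarrow> calculus A g"
    using calculus_continuous by blast
qed

text \<open>The values at 1 and at the identity function determine \<Phi> on polynomials through the
  algebraic laws, and continuity with density of polynomials determines the rest.\<close>

lemma functional_calculus_unique:
  assumes \<Phi>: "is_functional_calculus A \<Phi>" and g: "continuous_on (spectrum A) g"
  shows "\<Phi> g = calculus A g"
proof -
  note fc = \<Phi>[unfolded is_functional_calculus_def Let_def, THEN conjunct2, THEN conjunct2]
  note fc' = fc[THEN conjunct2, THEN conjunct2, THEN conjunct2, THEN conjunct2]
  let ?C = "{g. continuous_on (spectrum A) g}"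
  have \<Phi>_add: "\<forall>g\<in>?C. \<forall>h\<in>?C. \<Phi> (\<lambda>z. g z + h z) = \<Phi> g + \<Phi> h"
    by (rule fc[THEN conjunct1])
  have \<Phi>_cmult: "\<forall>g\<in>?C. \<forall>c x. blinfun_apply (\<Phi> (\<lambda>z. c * g z)) x = c *\<^sub>C blinfun_apply (\<Phi> g) x"
    by (rule fc[THEN conjunct2, THEN conjunct1])
  have \<Phi>_mult: "\<forall>g\<in>?C. \<forall>h\<in>?C. \<Phi> (\<lambda>z. g z * h z) = \<Phi> g o\<^sub>L \<Phi> h"
    by (rule fc[THEN conjunct2, THEN conjunct2, THEN conjunct1])
  have \<Phi>_one: "\<Phi> (\<lambda>z. 1) = id_blinfun" by (rule fc'[THEN conjunct1])
  have \<Phi>_ident: "\<Phi> (\<lambda>z. z) = A" by (rule fc'[THEN conjunct2, THEN conjunct1])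
  have \<Phi>_lim: "\<forall>G. \<forall>g\<in>?C. (\<forall>n::nat. G n \<in> ?C) \<and> uniform_limit (spectrum A) G g sequentially \<longrightarrow>
      (\<lambda>n. \<Phi> (G n)) \<longlonglongrightarrow> \<Phi> g"
    by (rule fc'[THEN conjunct2, THEN conjunct2])
  have \<Phi>_const: "\<Phi> (\<lambda>z. c) = cscale c" for c
    using \<Phi>_cmult[THEN bspec[of _ _ "\<lambda>z. 1"]] by (intro blinfun_eqI) (simp add: \<Phi>_one)
  have \<Phi>_poly: "\<Phi> (poly p) = op_poly A p" for p
  proof (induction p)
    case 0
    have "poly (0::complex poly) = (\<lambda>z. 0)" by auto
    then show ?case by (simp add: \<Phi>_const)
  next
    case (pCons a p)
    have "poly (pCons a p) = (\<lambda>z. a + z * poly p z)" by auto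
    moreover have "\<Phi> (\<lambda>z. a + z * poly p z) = \<Phi> (\<lambda>z. a) + \<Phi> (\<lambda>z. z * poly p z)"
      by (intro \<Phi>_add[THEN bspec, THEN bspec] CollectI continuous_intros)
    moreover have "\<Phi> (\<lambda>z. z * poly p z) = \<Phi> (\<lambda>z. z) o\<^sub>L \<Phi> (poly p)"
      by (intro \<Phi>_mult[THEN bspec, THEN bspec] CollectI continuous_intros)
    ultimately show ?case
      by (simp add: \<Phi>_const \<Phi>_ident pCons.IH op_poly_pCons)
  qed
  obtain P where P: "uniform_limit (spectrum A) (\<lambda>n. poly (P n)) g sequentially"
    using spectrum_approx[OF g] by blast
  have "(\<lambda>n. \<Phi> (poly (P n))) \<longlonglongrightarrow> \<Phi> g"
    using g P by (intro \<Phi>_lim[rule_format]) (auto intro: continuous_intros)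
  then show ?thesis
    using LIMSEQ_unique[OF _ calculus_tendsto[OF P]] by (simp add: \<Phi>_poly)
qed

lemma cfc_eq_calculus:
  assumes "continuous_on (spectrum A) (\<lambda>z. complex_of_real (f (Re z)))"
  shows "cfc f A = calculus A (\<lambda>z. complex_of_real (f (Re z)))"
  unfolding cfc_def
proof (rule the_equality)
  show "\<exists>\<Phi>. is_functional_calculus A \<Phi> \<and>
      calculus A (\<lambda>z. complex_of_real (f (Re z))) = \<Phi> (\<lambda>z. complex_of_real (f (Re z)))"
    using is_functional_calculus_calculus by blast
qed (use functional_calculus_unique[OF _ assms] in blast)

end

section \<open>The chord inequality\<close>

lemma op_le_trans: "op_le A B \<Longrightarrow> op_le B C \<Longrightarrow> op_le A C"
  unfolding op_le_def by (meson order_trans)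

lemma op_le_add: "op_le A B \<Longrightarrow> op_le C D \<Longrightarrow> op_le (A + C) (B + D)"
  by (auto simp: op_le_def self_adjoint_add blinfun.add_left cinner_add_left intro: add_mono)

lemma op_between_add: "op_between m A M \<Longrightarrow> op_between n B N \<Longrightarrow> op_between (m + n) (A + B) (M + N)"
  by (auto simp: op_between_def blinfun.add_left cinner_add_left distrib_right intro: add_mono)

section \<open>The calculus for real functions on an interval\<close>

context
  fixes A :: "'a::complex_hilbert \<Rightarrow>\<^sub>L 'a" and m M :: real
  assumes A: "self_adjoint A" and A_between: "op_between m A M"
begin

lemma continuous_on_spectrum:
  assumes "continuous_on {m..M} f"
  shows "continuous_on (spectrum A) (\<lambda>z. complex_of_real (f (Re z)))"
proof -
  have "Re ` spectrum A \<subseteq> {m..M}" using spectrum_real[OF A A_between] by blast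
  then have "continuous_on (spectrum A) (\<lambda>z. f (Re z))"
    by (intro continuous_on_compose2[OF assms] continuous_intros)
  then show ?thesis by (rule continuous_on_of_real)
qed

lemma cfc_eq:
  assumes "continuous_on {m..M} f"
  shows "cfc f A = calculus A (\<lambda>z. complex_of_real (f (Re z)))"
  by (rule cfc_eq_calculus[OF A continuous_on_spectrum[OF assms]])

lemma self_adjoint_cfc:
  assumes "continuous_on {m..M} f"
  shows "self_adjoint (cfc f A)"
  using calculus_bounded_ops[OF A continuous_on_spectrum[OF assms]]
    calculus_adjoint[OF A continuous_on_spectrum[OF assms]]
  by (simp add: self_adjoint_def cfc_eq[OF assms])

lemma cfc_scaleR:
  assumes "continuous_on {m..M} f"
  shows "cfc (\<lambda>t. c * f t) A = c *\<^sub>R cfc f A"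
proof -
  have "continuous_on {m..M} (\<lambda>t. c * f t)" by (intro continuous_intros assms)
  then show ?thesis
    using calculus_cmult[OF A continuous_on_spectrum[OF assms], of "complex_of_real c"]
    by (simp add: cfc_eq assms) (intro blinfun_eqI, simp add: blinfun.scaleR_left scaleR_eq_scaleC)
qed

lemma cfc_affine: "cfc (\<lambda>t. a * t + b) A = a *\<^sub>R A + b *\<^sub>R id_blinfun"
proof -
  have "cfc (\<lambda>t. a * t + b) A = calculus A (\<lambda>z. complex_of_real (a * Re z + b))"
    by (rule cfc_eq) (intro continuous_intros)
  \<comment> \<open>On the spectrum \<open>Re z\<close> equals \<open>z\<close>, so the affine
    function is a polynomial there.\<close>
  also have "\<dots> = calculus A (poly [:complex_of_real b, complex_of_real a:])"
    by (rule calculus_cong[OF A])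
      (use spectrum_of_real_Re[OF A] in \<open>auto intro!: continuous_intros simp: mult.commute\<close>)
  also have "\<dots> = cscale (complex_of_real b) + (A o\<^sub>L cscale (complex_of_real a))"
    by (simp add: calculus_poly[OF A] op_poly_pCons)
  also have "\<dots> = a *\<^sub>R A + b *\<^sub>R id_blinfun"
    by (rule blinfun_eqI)
      (simp add: blinfun.add_left blinfun.scaleR_left blinfun.scaleR_right flip: scaleR_eq_scaleC)
  finally show ?thesis .
qed

text \<open>With \<open>h\<close> the square root of \<open>g - f\<close>, the difference
  \<open>cfc g A - cfc f A\<close> is the square of the self-adjoint operator
  \<open>cfc h A\<close>, so its quadratic form at \<open>x\<close> is the squared norm of
  \<open>cfc h A\<close> applied to \<open>x\<close>.\<close>

lemma cfc_mono:
  assumes f: "continuous_on {m..M} f" and g: "continuous_on {m..M} g"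
    and le: "\<And>t. t \<in> {m..M} \<Longrightarrow> f t \<le> g t"
  shows "op_le (cfc f A) (cfc g A)"
proof -
  define h where "h t = sqrt (g t - f t)" for t
  have h: "continuous_on {m..M} h"
    unfolding h_def by (intro continuous_intros f g)
  note cont = continuous_on_spectrum[OF f] continuous_on_spectrum[OF g] continuous_on_spectrum[OF h]
  have "calculus A (\<lambda>z. complex_of_real (g (Re z)) - complex_of_real (f (Re z))) =
      calculus A (\<lambda>z. complex_of_real (h (Re z)) * complex_of_real (h (Re z)))"
  proof (rule calculus_cong[OF A])
    show "continuous_on (spectrum A) (\<lambda>z. complex_of_real (g (Re z)) - complex_of_real (f (Re z)))"
      by (intro continuous_on_diff cont)
    show "complex_of_real (g (Re z)) - complex_of_real (f (Re z)) =
        complex_of_real (h (Re z)) * complex_of_real (h (Re z))" if "z \<in> spectrum A" for z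
      using le[of "Re z"] spectrum_real[OF A A_between that]
      by (simp add: h_def flip: of_real_mult of_real_diff)
  qed
  then have sq: "cfc g A - cfc f A = cfc h A o\<^sub>L cfc h A"
    by (simp only: calculus_diff[OF A cont(2,1)] calculus_mult[OF A cont(3,3)] cfc_eq f g h)
  have "Re (cinner (blinfun_apply (cfc f A) x) x) \<le> Re (cinner (blinfun_apply (cfc g A) x) x)" for x
  proof -
    have "cinner (blinfun_apply (cfc g A - cfc f A) x) x =
        cinner (blinfun_apply (cfc h A) x) (blinfun_apply (cfc h A) x)"
      unfolding sq by (simp add: self_adjoint_cinner[OF self_adjoint_cfc[OF h]])
    then have "Re (cinner (blinfun_apply (cfc g A - cfc f A) x) x) \<ge> 0"
      using cinner_ge_zero by metis
    then show ?thesis by (simp add: blinfun.diff_left cinner_diff_left)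
  qed
  then show ?thesis by (simp add: op_le_def self_adjoint_cfc f g)
qed

end

text \<open>The point-slope form of the chord is the one in which convexity on an interval is stated
  by \<open>convex_onD_Icc'\<close>.\<close>

lemma chord_ratio_mult:
  assumes "f t \<noteq> 0" "m \<noteq> M"
  shows "chord_ratio m M f t * f t = (f M - f m) / (M - m) * (t - m) + f m"
proof -
  have "chord_ratio m M f t * f t = (M - t) / (M - m) * f m + (t - m) / (M - m) * f M"
    using assms by (simp add: chord_ratio_def)
  also have "\<dots> = (f M - f m) / (M - m) * (t - m) + f m"
    using assms(2) by (simp add: divide_simps) (simp add: algebra_simps)
  finally show ?thesis .
qed

section \<open>Extreme values of the chord ratio\<close>

context
  fixes m M :: real and f :: "real \<Rightarrow> real"
  assumes mM: "m < M" and f: "continuous_on {m..M} f" and pos: "\<And>t. t \<in> {m..M} \<Longrightarrow> 0 < f t"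
begin

lemma continuous_on_chord_ratio: "continuous_on {m..M} (chord_ratio m M f)"
  unfolding chord_ratio_def using mM pos
  by (intro continuous_intros f) force+

lemma chord_ratio_le_K_const:
  assumes "t \<in> {m..M}"
  shows "chord_ratio m M f t \<le> K_const m M f"
proof -
  obtain s where s: "s \<in> {m..M}" "\<And>t. t \<in> {m..M} \<Longrightarrow> chord_ratio m M f t \<le> chord_ratio m M f s"
    using continuous_attains_sup[OF compact_Icc _ continuous_on_chord_ratio] mM by auto
  then have "K_const m M f = chord_ratio m M f s"
    unfolding K_const_def by (intro Greatest_equality) auto
  with s assms show ?thesis by simp
qed

text \<open>The minimizer is exposed because \<open>k_const\<close> must also be nonnegative, which
  follows from its being a value of the ratio; a mere lower bound would not give this.\<close>

lemma k_const_attained: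
  obtains s where "s \<in> {m..M}" "k_const m M f = chord_ratio m M f s"
    "\<And>t. t \<in> {m..M} \<Longrightarrow> chord_ratio m M f s \<le> chord_ratio m M f t"
proof -
  obtain s where s: "s \<in> {m..M}" "\<And>t. t \<in> {m..M} \<Longrightarrow> chord_ratio m M f s \<le> chord_ratio m M f t"
    using continuous_attains_inf[OF compact_Icc _ continuous_on_chord_ratio] mM by auto
  then have "k_const m M f = chord_ratio m M f s"
    unfolding k_const_def by (intro Least_equality) auto
  with s show thesis by (intro that)
qed

lemma chord_ratio_nonneg: "t \<in> {m..M} \<Longrightarrow> 0 \<le> chord_ratio m M f t"
  using mM pos[of t] pos[of m] pos[of M] by (auto simp: chord_ratio_def intro!: mult_nonneg_nonneg add_nonneg_nonneg divide_nonneg_nonneg)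

end

theorem theorem2p5:
  fixes A B :: "'a::complex_hilbert \<Rightarrow>\<^sub>L 'a"
    and m M :: real
    and f :: "real \<Rightarrow> real"
  assumes "0 < m" and "m < M"
    and "self_adjoint A" and "self_adjoint B"
    and "op_between m A M" and "op_between m B M"
    and "continuous_on {0..2 * M} f"
    and "\<And>t. t \<in> {0..2 * M} \<Longrightarrow> 0 \<le> f t"
    and "\<And>t. t \<in> {m..M} \<Longrightarrow> 0 < f t"
  shows "(convex_on {0..2 * M} f \<and> f 0 = 0 \<longrightarrow>
            op_le (cfc f A + cfc f B) (K_const m M f *\<^sub>R cfc f (A + B))) \<and>
         (concave_on {0..2 * M} f \<longrightarrow>
            op_le (k_const m M f *\<^sub>R cfc f (A + B)) (cfc f A + cfc f B))"
proof -
  note m = assms(1,2) and A = assms(3,5) and B = assms(4,6)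
  have AB: "self_adjoint (A + B)" "op_between (2 * m) (A + B) (2 * M)"
    using self_adjoint_add[OF assms(3,4)] op_between_add[OF assms(5,6)] by simp_all
  have f: "continuous_on {m..M} f" "continuous_on {2 * m..2 * M} f"
    by (rule continuous_on_subset[OF assms(7)]; use m in auto)+
  note pos = assms(9)
  have Kc: "continuous_on {2 * m..2 * M} (\<lambda>t. c * f t)" for c
    by (intro continuous_intros f)
  \<comment> \<open>\<open>a\<close> and \<open>b\<close> are the slope and intercept of the chord
    of \<open>f\<close> over the interval from \<open>m\<close> to \<open>M\<close>.\<close>
  define a where "a = (f M - f m) / (M - m)"
  define b where "b = f m - a * m"
  have aff: "continuous_on S (\<lambda>t. c * t + d)" for S and c d :: real
    by (intro continuous_intros)
  have chord: "chord_ratio m M f t * f t = a * t + b" if "t \<in> {m..M}" for t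
    using chord_ratio_mult[of f t m M] pos[OF that] m
    by (simp add: b_def right_diff_distrib flip: a_def)
  \<comment> \<open>Affine functions let the calculi of \<open>A\<close>, \<open>B\<close> and
    \<open>A + B\<close> be compared without any commutation; the two intercepts add up to
    \<open>2 * b\<close>.\<close>
  have sum: "cfc (\<lambda>t. a * t + b) A + cfc (\<lambda>t. a * t + b) B = cfc (\<lambda>t. a * t + 2 * b) (A + B)"
    by (simp add: cfc_affine[OF A] cfc_affine[OF B] cfc_affine[OF AB] scaleR_add_right
        flip: scaleR_left.add[of b b id_blinfun])
  have "op_le (cfc f A + cfc f B) (K_const m M f *\<^sub>R cfc f (A + B))"
    if convex: "convex_on {0..2 * M} f" and f0: "f 0 = 0"
  proof -
    have le: "f t \<le> a * t + b" if "t \<in> {m..M}" for t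
      using convex_onD_Icc'[OF convex_on_subset[OF convex, of "{m..M}"] that] m
      by (simp add: b_def right_diff_distrib flip: a_def)
    have "a * t + 2 * b \<le> K_const m M f * f t" if t: "t \<in> {2 * m..2 * M}" for t
    proof -
      have half: "t / 2 \<in> {m..M}" using t by simp
      \<comment> \<open>Nonnegativity of the constant is what allows multiplying the inequality
        between \<open>2 * f (t / 2)\<close> and \<open>f t\<close> by it.\<close>
      have K: "chord_ratio m M f (t / 2) \<le> K_const m M f" "0 \<le> K_const m M f"
        using chord_ratio_le_K_const[OF m(2) f(1) pos half] chord_ratio_nonneg[OF m(2) f(1) pos half] by auto
      \<comment> \<open>The point \<open>t / 2\<close> is the midpoint of 0 and \<open>t\<close>,
        and \<open>f 0 = 0\<close> removes the other endpoint.\<close>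
      have "2 * f (t / 2) \<le> f t"
        using convex_onD[OF convex, of "1 / 2" 0 t] t m f0 by simp
      then have "K_const m M f * (2 * f (t / 2)) \<le> K_const m M f * f t"
        using K(2) by (rule mult_left_mono)
      moreover have "chord_ratio m M f (t / 2) * f (t / 2) \<le> K_const m M f * f (t / 2)"
        using K(1) pos[OF half] by (intro mult_right_mono) auto
      ultimately show ?thesis using chord[OF half] by simp
    qed
    then have "op_le (cfc (\<lambda>t. a * t + 2 * b) (A + B)) (cfc (\<lambda>t. K_const m M f * f t) (A + B))"
      by (intro cfc_mono[OF AB] aff Kc)
    moreover have "op_le (cfc f A + cfc f B) (cfc (\<lambda>t. a * t + b) A + cfc (\<lambda>t. a * t + b) B)"
      by (intro op_le_add cfc_mono[OF A] cfc_mono[OF B] aff f le)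
    ultimately show ?thesis
      unfolding sum cfc_scaleR[OF AB f(2)] by (rule op_le_trans[rotated])
  qed
  moreover have "op_le (k_const m M f *\<^sub>R cfc f (A + B)) (cfc f A + cfc f B)"
    if concave: "concave_on {0..2 * M} f"
  proof -
    have convex: "convex_on {0..2 * M} (\<lambda>t. - f t)" using concave by (simp add: concave_on_def)
    have le: "a * t + b \<le> f t" if "t \<in> {m..M}" for t
    proof -
      have "- f t \<le> (- f M - - f m) / (M - m) * (t - m) + - f m"
        using convex_onD_Icc'[OF convex_on_subset[OF convex, of "{m..M}"] that] m by simp
      also have "(- f M - - f m) / (M - m) = - a"
        by (simp add: a_def minus_divide_left)
      finally show ?thesis by (simp add: b_def algebra_simps)
    qed
    have "k_const m M f * f t \<le> a * t + 2 * b" if t: "t \<in> {2 * m..2 * M}" for t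
    proof -
      have half: "t / 2 \<in> {m..M}" using t by simp
      have k: "k_const m M f \<le> chord_ratio m M f (t / 2)" "0 \<le> k_const m M f"
        using k_const_attained[OF m(2) f(1) pos] chord_ratio_nonneg[OF m(2) f(1) pos] half by metis+
      have "f t \<le> 2 * f (t / 2)"
        using convex_onD[OF convex, of "1 / 2" 0 t] t m assms(8)[of 0] by simp
      then have "k_const m M f * f t \<le> k_const m M f * (2 * f (t / 2))"
        using k(2) by (rule mult_left_mono)
      moreover have "k_const m M f * f (t / 2) \<le> chord_ratio m M f (t / 2) * f (t / 2)"
        using k(1) pos[OF half] by (intro mult_right_mono) auto
      ultimately show ?thesis using chord[OF half] by simp
    qed
    then have "op_le (cfc (\<lambda>t. k_const m M f * f t) (A + B)) (cfc (\<lambda>t. a * t + 2 * b) (A + B))"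
      by (intro cfc_mono[OF AB] aff Kc)
    moreover have "op_le (cfc (\<lambda>t. a * t + b) A + cfc (\<lambda>t. a * t + b) B) (cfc f A + cfc f B)"
      by (intro op_le_add cfc_mono[OF A] cfc_mono[OF B] aff f le)
    ultimately show ?thesis
      unfolding sum cfc_scaleR[OF AB f(2)] by (rule op_le_trans)
  qed
  ultimately show ?thesis by blast
qed

end
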